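(* Let $\lambda>0$, let $\Phi\in\mathbb{R}^{n\times m}$ be a feature matrix, let $\xi$ be the stationary distribution on the finite state space $\mathcal{X}$ induced by the policy $\pi$, and let $\tilde{\mathbf{P}}\in\mathbb{R}^{n\times k}$ be the fixed point of the process $\mathbf{P}_{t+1}=\hat{\boldsymbol{\Pi}}_{\xi,\lambda,\Phi}\mathcal{T}^\pi\mathbf{P}_t$, i.e. $\tilde{\mathbf{P}}=\hat{\boldsymbol{\Pi}}_{\xi,\lambda,\Phi}\mathcal{T}^\pi\tilde{\mathbf{P}}$. Then the squared expectation error of $\tilde{\mathbf{P}}$ with respect to the true value function $V^\pi$ is bounded as $$\big\|\mathbb{E}_{\tilde{\mathbf{P}}}\mathbf{z}-V^\pi\big\|^2_\xi\le\big\|C_\lambda^{-1/2}\mathbf{z}\big\|^2\,\ell^2_{\xi,\lambda}(\tilde{\mathbf{P}},\mathbf{P}^\pi).$$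
   Context: **MDP.** $\mathcal{X}$ is a finite state space with $|\mathcal{X}|=n$; $\pi$ is a fixed policy with induced transition kernel $\Pr_\pi(x'\mid x)$, and $\xi(x')=\sum_x\xi(x)\Pr_\pi(x'\mid x)$; $R(x)$ is a bounded random reward received on leaving $x$ (independent of the next state); $\gamma\in[0,1)$ is the discount factor. The random return is $Z^\pi(x)=\sum_{t\ge0}\gamma^tR(X_t)$, with $X_0=x$, $X_{t+1}\sim\Pr_\pi(\cdot\mid X_t)$. $\mathbf{P}^\pi(x)$ is the law of $Z^\pi(x)$, and $V^\pi(x)=\mathbb{E}[Z^\pi(x)]$. **Support.** $k\ge 3$ is odd, and $\mathbf{z}=(z_1,\dots,z_k)$, $z_i=\frac{2i-1-k}{2}$, denotes both the support and the column vector of its elements. A vector $p\in\mathbb{R}^k$ is identified with the signed measure $\sum_ip_i\delta_{z_i}$. For $\mathbf{P}\in\mathbb{R}^{n\times k}$ the row for state $x$ is $\mathbf{P}(x)\in\mathbb{R}^k$, and $\mathbb{E}_{\mathbf{P}}\mathbf{z}$ is the function $x\mapsto\mathbf{z}^\top\mathbf{P}(x)$. It is assumed that $R(x)+\gamma z_i\in[z_1,z_k)$ almost surely for all $x,i$. **Bellman operator.** $\mathcal{T}^\pi\mathbf{P}(x)$ is the (signed) measure $\sum_{x'}\Pr_\pi(x'\mid x)\,\mathbb{E}\big[(f_{R(x),\gamma})_\#\mathbf{P}(x')\big]$, where $f_{r,\gamma}(y)=r+\gamma y$ and $\#$ denotes pushforward. **Distances.** $e=[1/\sqrt{k},\dots,1/\sqrt{k}]^\top$,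 $\Pi_{e^\perp}=I_k-ee^\top$, $C$ is the $k\times k$ lower-triangular matrix of ones ($C_{ij}=1$ if $i\ge j$, else $0$), and $C_\lambda=\Pi_{e^\perp}CC^\top\Pi_{e^\perp}+\lambda ee^\top$. For $p,q\in\mathbb{R}^k$, $\ell^2_\lambda(p,q)=(p-q)^\top C_\lambda(p-q)$. It is extended to finite signed measures $\mu,\nu$ on $[z_1,z_k]$, consistently for measures on $\mathbf{z}$, as follows. Put $\mu^0=\mu-\mu(\mathbb{R})\frac1k\sum_i\delta_{z_i}$, similarly $\nu^0$, and $F_\mu(t)=\mu((-\infty,t])$; then $$\ell^2_\lambda(\mu,\nu)=\int_{z_1}^{z_k}(F_{\mu^0}(t)-F_{\nu^0}(t))^2dt+\frac{\lambda}{k}(\mu(\mathbb{R})-\nu(\mathbb{R}))^2.$$ For a measure $\mu$ and $q\in\mathbb{R}^k$, the normalization-penalized loss is $\hat\ell^2_\lambda(\mu,q)=\int_{z_1}^{z_k}(F_{\mu^0}-F_{q^0})^2dt+\lambda(q^\top e-\frac1{\sqrt k})^2$. Weighted versions: $\ell^2_{\xi,\lambda}(\mathbf{P},\mathbf{Q})=\sum_x\xi(x)\ell^2_\lambda(\mathbf{P}(x),\mathbf{Q}(x))$, and similarly $\hat\ell^2_{\xi,\lambda}$. For $V:\mathcal{X}\to\mathbb{R}$, $\|V\|_\xi^2=\sum_x\xi(x)V(x)^2$; $\|\cdot\|$ on $\mathbb{R}^k$ is the Euclidean norm. **Operator.** $\hat{\boldsymbol{\Pi}}_{\xi,\lambda,\Phi}\mathbf{P}=\Phi\Theta^*$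 with $\Theta^*\in\arg\min_{\Theta\in\mathbb{R}^{m\times k}}\hat\ell^2_{\xi,\lambda}(\mathbf{P},\Phi\Theta)$. *)

theory Defs
  imports "HOL-Probability.Probability"
begin

section \<open>Support and matrices\<close>

text \<open>
  Vectors in \<open>k\<close>-dimensional space have an ordered finite index type, so that
  \<open>coord_index j\<close> is the usual 1-based index of the coordinate \<open>j\<close>.
\<close>

definition coord_index :: "'k::{finite,wellorder} \<Rightarrow> nat" where
  "coord_index j = card {..j}"

definition grid_point :: "nat \<Rightarrow> nat \<Rightarrow> real" where
  "grid_point k i = (2 * real i - 1 - real k) / 2"

definition zvec :: "real^'k::{finite,wellorder}" where
  "zvec = (\<chi> j. grid_point CARD('k) (coord_index j))"

definition evec :: "real^'k" where
  "evec = (\<chi> j. 1 / sqrt (real CARD('k)))"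

definition eeT :: "real^'k^'k" where
  "eeT = (\<chi> i j. evec $ i * evec $ j)"

definition Cmat :: "real^'k::{finite,wellorder}^'k::{finite,wellorder}" where
  "Cmat = (\<chi> i j. if j \<le> i then 1 else 0)"

definition C_lam :: "real \<Rightarrow> real^'k::{finite,wellorder}^'k::{finite,wellorder}" where
  "C_lam lam = (mat 1 - eeT) ** Cmat ** transpose Cmat ** (mat 1 - eeT) + lam *\<^sub>R eeT"

definition psd :: "real^'k^'k \<Rightarrow> bool" where
  "psd A \<longleftrightarrow> transpose A = A \<and> (\<forall>v. 0 \<le> v \<bullet> (A *v v))"

text \<open>The power \<open>-1/2\<close>: the positive semidefinite square root of the inverse.\<close>

definition matrix_inv_sqrt :: "real^'k^'k \<Rightarrow> real^'k^'k" where
  "matrix_inv_sqrt A = (THE S. psd S \<and> S ** S = matrix_inv A)"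


section \<open>Signed measures and distances\<close>

text \<open>
  A finite signed Borel measure on the real line is represented by its set function;
  only the values on Borel sets matter.
\<close>

type_synonym smeasure = "real set \<Rightarrow> real"

definition vec_measure :: "real^'k::{finite,wellorder} \<Rightarrow> smeasure" where
  "vec_measure p B = (\<Sum>j\<in>UNIV. p $ j * indicator B (zvec $ j :: real))"

definition centred :: "nat \<Rightarrow> smeasure \<Rightarrow> smeasure" where
  "centred k \<mu> B = \<mu> B - \<mu> UNIV * (1 / real k) * (\<Sum>i=1..k. indicator B (grid_point k i))"

definition scdf :: "smeasure \<Rightarrow> real \<Rightarrow> real" where
  "scdf \<mu> t = \<mu> {..t}"

definition cramer :: "nat \<Rightarrow> smeasure \<Rightarrow> smeasure \<Rightarrow> real" where
  "cramer k \<mu> \<nu> =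
     (LINT t:{grid_point k 1..grid_point k k}|lborel. (scdf (centred k \<mu>) t - scdf (centred k \<nu>) t)\<^sup>2)"

text \<open>
  For \<open>p q :: real^'k\<close>, \<open>ell2 CARD('k) lam (vec_measure p) (vec_measure q)\<close> is the quadratic
  form \<open>(p - q) \<bullet> (C_lam lam *v (p - q))\<close>; the integral form extends it to arbitrary
  finite signed measures on the interval spanned by the support.
\<close>

definition ell2 :: "nat \<Rightarrow> real \<Rightarrow> smeasure \<Rightarrow> smeasure \<Rightarrow> real" where
  "ell2 k lam \<mu> \<nu> = cramer k \<mu> \<nu> + lam / real k * (\<mu> UNIV - \<nu> UNIV)\<^sup>2"

definition ell2_hat :: "real \<Rightarrow> smeasure \<Rightarrow> real^'k::{finite,wellorder} \<Rightarrow> real" where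
  "ell2_hat lam \<mu> q =
     cramer CARD('k) \<mu> (vec_measure q) + lam * (q \<bullet> evec - 1 / sqrt (real CARD('k)))\<^sup>2"

definition ell2_w :: "nat \<Rightarrow> 'x::finite pmf \<Rightarrow> real \<Rightarrow> ('x \<Rightarrow> smeasure) \<Rightarrow> ('x \<Rightarrow> smeasure) \<Rightarrow> real" where
  "ell2_w k \<xi> lam P Q = (\<Sum>x\<in>UNIV. pmf \<xi> x * ell2 k lam (P x) (Q x))"

definition ell2_hat_w ::
    "'x::finite pmf \<Rightarrow> real \<Rightarrow> ('x \<Rightarrow> smeasure) \<Rightarrow> real^'k::{finite,wellorder}^'x \<Rightarrow> real" where
  "ell2_hat_w \<xi> lam P Q = (\<Sum>x\<in>UNIV. pmf \<xi> x * ell2_hat lam (P x) (Q $ x))"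

definition sqnorm_w :: "'x::finite pmf \<Rightarrow> ('x \<Rightarrow> real) \<Rightarrow> real" where
  "sqnorm_w \<xi> V = (\<Sum>x\<in>UNIV. pmf \<xi> x * (V x)\<^sup>2)"


section \<open>Random return\<close>

text \<open>
  \<open>K\<close> is the transition kernel induced by the fixed policy and \<open>rew x\<close> the law of the
  reward received on leaving \<open>x\<close>.  The finite-dimensional laws below say that
  \<open>X\<close> is a Markov chain with kernel \<open>K\<close> started in \<open>x\<close>, and that given the chain
  the rewards \<open>R t\<close> are independent with law \<open>rew (X t)\<close>.
\<close>

definition trajectory ::
    "('x \<Rightarrow> 'x pmf) \<Rightarrow> ('x \<Rightarrow> real measure) \<Rightarrow> 'x \<Rightarrow> 'w measure \<Rightarrow>
     (nat \<Rightarrow> 'w \<Rightarrow> 'x) \<Rightarrow> (nat \<Rightarrow> 'w \<Rightarrow> real) \<Rightarrow> bool" where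
  "trajectory K rew x M X R \<longleftrightarrow>
     prob_space M \<and>
     (\<forall>t. X t \<in> measurable M (count_space UNIV)) \<and>
     (\<forall>t. R t \<in> borel_measurable M) \<and>
     (\<forall>n xs B. (\<forall>t. B t \<in> sets borel) \<longrightarrow>
        measure M {\<omega> \<in> space M. \<forall>t\<le>n. X t \<omega> = xs t \<and> R t \<omega> \<in> B t} =
          (if xs 0 = x then 1 else 0) *
          (\<Prod>t<n. pmf (K (xs t)) (xs (Suc t))) *
          (\<Prod>t\<le>n. measure (rew (xs t)) (B t)))"

definition disc_return :: "real \<Rightarrow> (nat \<Rightarrow> 'w \<Rightarrow> real) \<Rightarrow> 'w \<Rightarrow> real" where
  "disc_return \<gamma> R \<omega> = (\<Sum>t. \<gamma> ^ t * R t \<omega>)"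

definition return_law :: "real \<Rightarrow> 'w measure \<Rightarrow> (nat \<Rightarrow> 'w \<Rightarrow> real) \<Rightarrow> smeasure" where
  "return_law \<gamma> M R B = measure (distr M borel (disc_return \<gamma> R)) B"

definition return_mean :: "real \<Rightarrow> 'w measure \<Rightarrow> (nat \<Rightarrow> 'w \<Rightarrow> real) \<Rightarrow> real" where
  "return_mean \<gamma> M R = (LINT \<omega>|M. disc_return \<gamma> R \<omega>)"


section \<open>Bellman operator and projection\<close>

definition bellman ::
    "('x::finite \<Rightarrow> 'x pmf) \<Rightarrow> ('x \<Rightarrow> real measure) \<Rightarrow> real \<Rightarrow> ('x \<Rightarrow> smeasure) \<Rightarrow> 'x \<Rightarrow> smeasure" where
  "bellman K rew \<gamma> P x B =
     (\<Sum>x'\<in>UNIV. pmf (K x) x' * (LINT r|rew x. P x' ((\<lambda>y. r + \<gamma> * y) -` B)))"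

text \<open>
  The minimiser \<open>\<Theta>\<close> need not be unique, so the projection is a relation:
  \<open>Q = \<Phi> ** \<Theta>\<close> for some minimiser \<open>\<Theta>\<close>.
\<close>

definition is_proj ::
    "'x::finite pmf \<Rightarrow> real \<Rightarrow> real^'m^'x \<Rightarrow> ('x \<Rightarrow> smeasure) \<Rightarrow> real^'k::{finite,wellorder}^'x \<Rightarrow> bool" where
  "is_proj \<xi> lam \<Phi> P Q \<longleftrightarrow>
     (\<exists>\<Theta> :: real^'k::{finite,wellorder}^'m.
        is_arg_min (\<lambda>\<Theta>'. ell2_hat_w \<xi> lam P (\<Phi> ** \<Theta>')) (\<lambda>_. True) \<Theta> \<and> Q = \<Phi> ** \<Theta>)"

end

theory Submission
  imports Defs
begin

text \<open>
  The inequality holds state by state, for an arbitrary vector \<open>p\<close> in place of the row of the fixed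
  point.  Since the support is symmetric about \<open>0\<close>, centring does not change means, so
  \<open>z \<bullet> p\<close> minus the mean of the return is, up to sign, the integral over \<open>[z_1, z_k]\<close> of the
  difference of the two centred distribution functions.  By Cauchy-Schwarz its square is at most
  \<open>k - 1\<close> times the Cramer part of the distance.  The constant \<open>k - 1\<close> is \<open>\<parallel>C_\<lambda>\<^sup>-\<^sup>1\<^sup>/\<^sup>2 z\<parallel>\<^sup>2\<close>, because
  \<open>C_\<lambda> w = z\<close> for \<open>w = \<delta>_k - \<delta>_1\<close> and \<open>w \<bullet> z = z_k - z_1\<close>.
\<close>

subsection \<open>Positive semidefinite square roots\<close>

text \<open>Rayleigh quotient argument: the quadratic form \<open>x \<bullet> f x\<close> attains
  its maximum on the compact unit sphere of \<open>V\<close>, and a maximiser is an eigenvector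
  because the form cannot increase to first order along any direction of \<open>V\<close>.\<close>

lemma selfadjoint_eigenvector_exists:
  fixes f :: "'a::euclidean_space \<Rightarrow> 'a"
  assumes "linear f" and sym: "\<And>x y. x \<bullet> f y = f x \<bullet> y"
    and V: "subspace V" "f ` V \<subseteq> V" "V \<noteq> {0}"
  obtains u c where "u \<in> V" "norm u = 1" "f u = c *\<^sub>R u"
proof -
  interpret f: linear f by fact
  have cont: "continuous_on S f" for S
    using \<open>linear f\<close> by (simp add: linear_continuous_on linear_linear)
  obtain v where v: "v \<in> V" "v \<noteq> 0"
    using V subspace_0 by fastforce
  let ?S = "sphere 0 1 \<inter> V"
  have "compact ?S"
    by (simp add: V(1) closed_subspace compact_Int_closed)
  moreover have "v /\<^sub>R norm v \<in> ?S"
    using v V(1) by (simp add: subspace_scale)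
  then have "?S \<noteq> {}" by blast
  moreover have "continuous_on ?S (\<lambda>x. x \<bullet> f x)"
    by (intro continuous_intros cont)
  ultimately obtain u where u: "u \<in> ?S" and max: "\<And>y. y \<in> ?S \<Longrightarrow> y \<bullet> f y \<le> u \<bullet> f u"
    using continuous_attains_sup[of ?S "\<lambda>x. x \<bullet> f x"] by blast
  define c where "c = u \<bullet> f u"
  have uV: "u \<in> V" and nu: "norm u = 1" and uu: "u \<bullet> u = 1"
    using u by (auto simp: dot_square_norm)
  \<comment> \<open>By homogeneity the bound on the unit sphere extends to all of
    \<open>V\<close>.\<close>
  have quad: "y \<bullet> f y \<le> c * (y \<bullet> y)" if "y \<in> V" for y
  proof (cases "y = 0")
    case False
    have "y /\<^sub>R norm y \<in> ?S"
      using that False V(1) by (simp add: subspace_scale)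
    from max[OF this] have "(y \<bullet> f y) / (norm y)\<^sup>2 \<le> c"
      by (simp add: f.scale c_def power2_eq_square field_simps)
    then show ?thesis
      using False by (simp add: dot_square_norm field_simps)
  qed (simp add: f.zero)
  \<comment> \<open>The residual of the eigenvector equation, shown to vanish. It lies in
    \<open>V\<close> and is orthogonal to \<open>u\<close>, hence is an admissible direction in
    which to perturb \<open>u\<close>.\<close>
  define w where "w = f u - c *\<^sub>R u"
  have wV: "w \<in> V"
    unfolding w_def using uV V by (auto intro!: subspace_diff subspace_scale)
  have uw: "u \<bullet> w = 0"
    by (simp add: w_def inner_diff_right uu c_def)
  have fu: "f u = w + c *\<^sub>R u" by (simp add: w_def)
  have wfu: "w \<bullet> f u = w \<bullet> w" using uw by (simp add: fu inner_add_right inner_commute)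
  have ufw: "u \<bullet> f w = w \<bullet> w" using sym[of u w] wfu by (simp add: inner_commute)
  define d where "d = w \<bullet> f w - c * (w \<bullet> w)"
  \<comment> \<open>This is \<open>quad\<close> at \<open>u + t *\<^sub>R w\<close>, with the
    zeroth-order terms cancelled.\<close>
  have key: "2 * t * (w \<bullet> w) + t\<^sup>2 * d \<le> 0" for t
  proof -
    have "u + t *\<^sub>R w \<in> V" using uV wV V(1) by (simp add: subspace_add subspace_scale)
    from quad[OF this] show ?thesis
      using uw uu by (simp add: f.add f.scale inner_add_left inner_add_right wfu ufw c_def[symmetric]
          inner_commute[of w u] d_def power2_eq_square algebra_simps)
  qed
  have "w \<bullet> w = 0"
  proof (rule ccontr)
    assume "w \<bullet> w \<noteq> 0"
    then have pos: "w \<bullet> w > 0" by simp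
    \<comment> \<open>So small that the quadratic term cannot outweigh the linear one:
      \<open>t * \<bar>d\<bar>\<close> is at most \<open>w \<bullet> w\<close>, against
      \<open>2 * (w \<bullet> w)\<close>.\<close>
    define t where "t = (w \<bullet> w) / (1 + \<bar>d\<bar>)"
    have tpos: "t > 0" using pos by (simp add: t_def)
    have "t * (2 * (w \<bullet> w) + t * d) \<le> 0"
      using key[of t] by (simp add: power2_eq_square algebra_simps)
    then have "2 * (w \<bullet> w) + t * d \<le> 0"
      using tpos by (simp add: mult_le_0_iff)
    moreover have "t * \<bar>d\<bar> \<le> w \<bullet> w"
      using pos by (simp add: t_def field_simps)
    moreover have "- (t * \<bar>d\<bar>) \<le> t * d"
      using tpos by (metis abs_ge_minus_self abs_mult abs_of_pos minus_le_iff)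
    ultimately show False using pos by linarith
  qed
  then have "f u = c *\<^sub>R u" using fu by simp
  then show thesis using that uV nu by blast
qed

text \<open>Induction on the dimension: split off a unit eigenvector \<open>u\<close>; by symmetry
  of \<open>f\<close>, the orthogonal complement of \<open>u\<close> in \<open>V\<close> is again
  invariant, and it has smaller dimension.\<close>

lemma selfadjoint_orthonormal_eigenbasis:
  fixes f :: "'a::euclidean_space \<Rightarrow> 'a"
  assumes lin: "linear f" and sym: "\<And>x y. x \<bullet> f y = f x \<bullet> y"
    and "subspace V" "f ` V \<subseteq> V"
  shows "\<exists>B. B \<subseteq> V \<and> pairwise orthogonal B \<and> (\<forall>b\<in>B. norm b = 1) \<and> V \<subseteq> span B
    \<and> (\<forall>b\<in>B. \<exists>c. f b = c *\<^sub>R b)"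
  using assms(3,4)
proof (induction "dim V" arbitrary: V rule: less_induct)
  case less
  show ?case
  proof (cases "V = {0}")
    case True
    then show ?thesis by (intro exI[of _ "{}"]) auto
  next
    case False
    obtain u c where u: "u \<in> V" "norm u = 1" "f u = c *\<^sub>R u"
      using selfadjoint_eigenvector_exists[OF lin sym less.prems False] by blast
    have uu: "u \<bullet> u = 1" using u by (simp add: dot_square_norm)
    define W where "W = {y \<in> V. u \<bullet> y = 0}"
    have W: "subspace W"
      using less.prems(1) unfolding W_def subspace_def by (auto simp: inner_add_right)
    have "f ` W \<subseteq> W"
      using less.prems(2) u sym unfolding W_def by auto
    moreover have "dim W < dim V"
    proof (rule dim_psubset)
      have "u \<notin> W" using uu by (simp add: W_def)
      with u(1) have "W \<subset> V" unfolding W_def by blast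
      then show "span W \<subset> span V"
        using W less.prems(1) by (simp add: span_eq_iff[THEN iffD2])
    qed
    ultimately obtain B where B: "B \<subseteq> W" "pairwise orthogonal B" "\<forall>b\<in>B. norm b = 1"
        "W \<subseteq> span B" "\<forall>b\<in>B. \<exists>c. f b = c *\<^sub>R b"
      using less.hyps[OF _ W] by meson
    have "V \<subseteq> span (insert u B)"
    proof
      fix x assume x: "x \<in> V"
      have "x - (u \<bullet> x) *\<^sub>R u \<in> W"
        using x u uu less.prems(1)
        by (auto simp: W_def inner_diff_right intro!: subspace_diff subspace_scale)
      then show "x \<in> span (insert u B)"
        using B(4) unfolding span_insert by blast
    qed
    moreover have "pairwise orthogonal (insert u B)"
      using B(1,2) by (auto simp: pairwise_insert W_def orthogonal_def inner_commute)
    ultimately show ?thesis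
      using B u W_def by (intro exI[of _ "insert u B"]) auto
  qed
qed

lemma psd_inner: "psd A \<Longrightarrow> x \<bullet> (A *v y) = (A *v x) \<bullet> y"
  unfolding psd_def by (metis dot_lmul_matrix transpose_matrix_vector)

lemma psd_eigenbasis:
  fixes A :: "real^'n^'n"
  assumes "psd A"
  obtains B a where "finite B" "pairwise orthogonal B" "\<And>b. b \<in> B \<Longrightarrow> norm b = 1"
    "span B = UNIV" "\<And>b. b \<in> B \<Longrightarrow> A *v b = a b *\<^sub>R b" "\<And>b. b \<in> B \<Longrightarrow> 0 \<le> (a b :: real)"
proof -
  obtain B where B: "pairwise orthogonal B" "\<forall>b\<in>B. norm b = 1" "span B = UNIV"
      "\<forall>b\<in>B. \<exists>c. A *v b = c *\<^sub>R b"
    using selfadjoint_orthonormal_eigenbasis[OF matrix_vector_mul_linear psd_inner[OF assms], of UNIV]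
    by auto
  then obtain a where a: "\<And>b. b \<in> B \<Longrightarrow> A *v b = a b *\<^sub>R b" by metis
  have "0 \<le> a b" if "b \<in> B" for b
  proof -
    have "0 \<le> b \<bullet> (A *v b)" using assms by (auto simp: psd_def)
    then show ?thesis using a[OF that] B(2) that by (simp add: dot_square_norm)
  qed
  moreover have "finite B"
    using B(1,2) by (intro independent_imp_finite pairwise_orthogonal_independent) auto
  ultimately show thesis using that B a by blast
qed

text \<open>Factor \<open>T^2 - s^2\<close> as \<open>(T + s)(T - s)\<close>: the vector
  \<open>w = T b - s b\<close> satisfies \<open>T w = - s w\<close>, which positive semidefiniteness
  allows only for \<open>w = 0\<close> when \<open>s > 0\<close>. For \<open>s = 0\<close>, symmetry
  gives \<open>w \<bullet> w = b \<bullet> T w = 0\<close>.\<close>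

lemma psd_square_eigenvector:
  fixes T :: "real^'n^'n"
  assumes T: "psd T" and s: "0 \<le> s" and b: "T *v (T *v b) = s\<^sup>2 *\<^sub>R b"
  shows "T *v b = s *\<^sub>R b"
proof -
  define w where "w = T *v b - s *\<^sub>R b"
  have Tw: "T *v w = - s *\<^sub>R w"
    by (simp add: w_def b matrix_vector_mult_diff_distrib matrix_vector_mult_scaleR
        power2_eq_square algebra_simps)
  have "0 \<le> w \<bullet> (T *v w)" using T by (auto simp: psd_def)
  then have *: "s * (w \<bullet> w) \<le> 0" by (simp add: Tw)
  have "w = 0"
  proof (cases "s = 0")
    case True
    have "w \<bullet> w = b \<bullet> (T *v w)"
      using psd_inner[OF T, of b w] by (simp add: w_def True)
    then show ?thesis using Tw True by simp
  next
    case False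
    then have "w \<bullet> w \<le> 0" using * s by (simp only: mult_le_0_iff) linarith
    then show ?thesis by (metis inner_eq_zero_iff inner_ge_zero order_antisym)
  qed
  then show ?thesis by (simp add: w_def)
qed

text \<open>An eigenbasis of \<open>S\<close> alone suffices: on an eigenvector \<open>b\<close> of
  \<open>S\<close>, the square of \<open>T\<close> acts as the square of the eigenvalue, so
  \<open>T\<close> itself acts as the nonnegative eigenvalue. No simultaneous diagonalisation is
  involved.\<close>

lemma psd_sqrt_unique:
  fixes S T :: "real^'n^'n"
  assumes S: "psd S" and T: "psd T" and eq: "S ** S = T ** T"
  shows "S = T"
proof -
  obtain B a where B: "span B = UNIV" "\<And>b. b \<in> B \<Longrightarrow> S *v b = a b *\<^sub>R b" "\<And>b. b \<in> B \<Longrightarrow> 0 \<le> (a b :: real)"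
    using psd_eigenbasis[OF S] by metis
  have "S *v x = T *v x" for x
  proof (rule linear_eq_on[OF matrix_vector_mul_linear matrix_vector_mul_linear])
    show "x \<in> span B" using B(1) by simp
    fix b assume b: "b \<in> B"
    have "T *v (T *v b) = (a b)\<^sup>2 *\<^sub>R b"
      unfolding matrix_vector_mul_assoc eq[symmetric]
      by (simp add: matrix_vector_mul_assoc[symmetric] B(2)[OF b] matrix_vector_mult_scaleR power2_eq_square)
    then show "S *v b = T *v b"
      using psd_square_eigenvector[OF T B(3)[OF b]] B(2)[OF b] by simp
  qed
  then show ?thesis by (simp add: matrix_eq)
qed

text \<open>The root has the same eigenbasis, with the square roots of the eigenvalues.\<close>

lemma psd_sqrt_exists:
  fixes A :: "real^'n^'n"
  assumes "psd A"
  obtains S where "psd S" "S ** S = A"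
proof -
  obtain B a where B: "finite B" "pairwise orthogonal B" "\<And>b. b \<in> B \<Longrightarrow> norm b = 1"
    "span B = UNIV" "\<And>b. b \<in> B \<Longrightarrow> A *v b = a b *\<^sub>R b" "\<And>b. b \<in> B \<Longrightarrow> 0 \<le> (a b :: real)"
    using psd_eigenbasis[OF assms] by metis
  define f :: "real^'n \<Rightarrow> real^'n" where "f x = (\<Sum>b\<in>B. (sqrt (a b) * (b \<bullet> x)) *\<^sub>R b)" for x
  have "linear f"
    unfolding f_def by (intro linearI)
      (simp_all add: inner_add_right distrib_left scaleR_add_left sum.distrib scaleR_sum_right mult.left_commute)
  define S where "S = matrix f"
  have S: "S *v x = f x" for x
    using matrix_works[OF \<open>linear f\<close>[unfolded linear_matrix_vector_mul_eq[symmetric]], of x] by (simp add: S_def)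
  have fb: "f b = sqrt (a b) *\<^sub>R b" if "b \<in> B" for b
  proof -
    have "f b = (\<Sum>c\<in>B. if c = b then sqrt (a b) *\<^sub>R b else 0)"
      unfolding f_def using B(2) B(3) that
      by (intro sum.cong) (auto simp: pairwise_def orthogonal_def dot_square_norm)
    then show ?thesis using B(1) that by simp
  qed
  have inner: "x \<bullet> f y = (\<Sum>b\<in>B. sqrt (a b) * (b \<bullet> x) * (b \<bullet> y))" for x y
    by (simp add: f_def inner_sum_right inner_commute mult_ac)
  have "transpose S = S"
  proof -
    have "(transpose S *v x) \<bullet> y = (S *v x) \<bullet> y" for x y
    proof -
      have "(transpose S *v x) \<bullet> y = x \<bullet> f y"
        by (simp add: dot_lmul_matrix S)
      also have "\<dots> = f x \<bullet> y"
        by (simp add: inner inner_commute[of "f x"] mult_ac)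
      finally show ?thesis by (simp add: S)
    qed
    then show ?thesis
      unfolding matrix_eq by (metis vector_eq_rdot)
  qed
  moreover have "0 \<le> x \<bullet> (S *v x)" for x
    unfolding S inner using B(6) by (intro sum_nonneg) (simp add: mult.assoc)
  ultimately have "psd S" by (simp add: psd_def)
  moreover have "S ** S = A"
  proof -
    have "(S ** S) *v x = A *v x" for x
    proof (rule linear_eq_on[OF matrix_vector_mul_linear matrix_vector_mul_linear])
      show "x \<in> span B" using B(4) by simp
      fix b assume b: "b \<in> B"
      have "(S ** S) *v b = (sqrt (a b) * sqrt (a b)) *\<^sub>R b"
        by (simp add: matrix_vector_mul_assoc[symmetric] S fb[OF b] linear_scale[OF \<open>linear f\<close>])
      then show "(S ** S) *v b = A *v b"
        using B(5)[OF b] B(6)[OF b] by simp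
    qed
    then show ?thesis by (simp add: matrix_eq)
  qed
  ultimately show thesis using that by blast
qed

text \<open>Existence and uniqueness of psd roots make the description in
  \<open>matrix_inv_sqrt\<close> well defined; its symmetry then turns the squared norm into the
  quadratic form of the inverse of \<open>A\<close>. Evaluating at \<open>A *v w\<close> removes the
  inverse, so that no explicit root has to be computed.\<close>

lemma norm_matrix_inv_sqrt:
  fixes A :: "real^'n^'n"
  assumes A: "transpose A = A" and pos: "\<And>v. v \<noteq> 0 \<Longrightarrow> 0 < v \<bullet> (A *v v)"
  shows "(norm (matrix_inv_sqrt A *v (A *v w)))\<^sup>2 = w \<bullet> (A *v w)"
proof -
  have "A *v x = 0 \<longrightarrow> x = 0" for x using pos[of x] by (cases "x = 0") auto
  then have "invertible A"
    unfolding invertible_left_inverse matrix_left_invertible_ker by blast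
  then have inv: "A ** matrix_inv A = mat 1" "matrix_inv A ** A = mat 1"
    using someI_ex[of "\<lambda>B. A ** B = mat 1 \<and> B ** A = mat 1"]
    by (auto simp: invertible_def matrix_inv_def)
  have sym: "x \<bullet> (A *v y) = (A *v x) \<bullet> y" for x y
    by (metis A dot_lmul_matrix transpose_matrix_vector)
  have AI: "A *v (matrix_inv A *v x) = x" "matrix_inv A *v (A *v x) = x" for x
    by (simp_all add: matrix_vector_mul_assoc inv)
  have "psd (matrix_inv A)"
    unfolding psd_def
  proof
    have "transpose (matrix_inv A) ** A = mat 1"
      by (metis A inv(1) matrix_transpose_mul transpose_mat)
    then show "transpose (matrix_inv A) = matrix_inv A"
      by (metis inv(1) matrix_mul_assoc matrix_mul_lid matrix_mul_rid)
    show "\<forall>v. 0 \<le> v \<bullet> (matrix_inv A *v v)"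
    proof
      fix v
      have "v \<bullet> (matrix_inv A *v v) = (matrix_inv A *v v) \<bullet> (A *v (matrix_inv A *v v))"
        by (simp add: AI inner_commute)
      then show "0 \<le> v \<bullet> (matrix_inv A *v v)"
        using pos[of "matrix_inv A *v v"] by (cases "matrix_inv A *v v = 0") auto
    qed
  qed
  then obtain S where S: "psd S" "S ** S = matrix_inv A"
    using psd_sqrt_exists by blast
  then have "matrix_inv_sqrt A = S"
    unfolding matrix_inv_sqrt_def by (intro the_equality) (auto intro: psd_sqrt_unique)
  then have "(norm (matrix_inv_sqrt A *v (A *v w)))\<^sup>2 = (A *v w) \<bullet> (S *v (S *v (A *v w)))"
    using psd_inner[OF S(1)] by (simp add: dot_square_norm[symmetric])
  also have "\<dots> = w \<bullet> (A *v w)"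
    by (simp add: matrix_vector_mul_assoc[of S S] S(2) AI inner_commute)
  finally show ?thesis .
qed

subsection \<open>The support grid\<close>

lemma sum_grid_point: "(\<Sum>i=1..k. grid_point k i) = 0"
proof -
  \<comment> \<open>The number of terms is decoupled from the constant in the summand so that the
    induction goes through; then both are set to \<open>k\<close>.\<close>
  have "(\<Sum>i=1..n. (2 * real i - 1 - c) / 2) = real n * (real n - c) / 2" for n and c :: real
    by (induction n) (simp_all add: field_simps)
  from this[of "real k" k] show ?thesis by (simp add: grid_point_def)
qed

lemma grid_point_in_interval:
  "i \<in> {1..k} \<Longrightarrow> grid_point k i \<in> {grid_point k 1..grid_point k k}"
  by (auto simp: grid_point_def divide_simps)

lemma coord_index_range: "coord_index (j :: 'k::{finite,wellorder}) \<in> {1..CARD('k)}"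
proof -
  have "{..j} \<noteq> {}" by blast
  then have "0 < card {..j}" by (simp add: card_gt_0_iff)
  then show ?thesis by (auto simp: coord_index_def intro: card_mono)
qed

text \<open>The rank is strictly monotone, hence injective, into a set of the same cardinality. This
  turns sums over the index type into sums over \<open>1..k\<close>.\<close>

lemma bij_betw_coord_index:
  "bij_betw coord_index (UNIV :: 'k::{finite,wellorder} set) {1..CARD('k)}"
proof -
  have "coord_index i < coord_index j" if "i < j" for i j :: 'k
    unfolding coord_index_def using that by (intro psubset_card_mono) auto
  then have inj: "inj (coord_index :: 'k \<Rightarrow> nat)"
    by (intro linorder_injI) (auto simp: neq_iff)
  moreover have "range (coord_index :: 'k \<Rightarrow> nat) = {1..CARD('k)}"
    using coord_index_range[where 'k='k] by (intro card_subset_eq) (auto simp: card_image[OF inj])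
  ultimately show ?thesis by (simp add: bij_betw_def)
qed

lemma sum_zvec: "(\<Sum>j\<in>UNIV. (zvec :: real^'k::{finite,wellorder}) $ j) = 0"
  using sum.reindex_bij_betw[OF bij_betw_coord_index[where 'k='k], of "grid_point CARD('k)"]
  by (simp add: zvec_def sum_grid_point[simplified])

lemma zvec_in_interval:
  "(zvec :: real^'k::{finite,wellorder}) $ j \<in> {grid_point CARD('k) 1..grid_point CARD('k) CARD('k)}"
  using grid_point_in_interval[OF coord_index_range] by (simp add: zvec_def)

subsection \<open>Means and the Cramer distance\<close>

text \<open>Cauchy-Schwarz against the constant function, obtained by expanding the nonnegative
  integral of the squared deviation of \<open>D\<close> from its average \<open>c\<close> on the
  interval.\<close>

lemma set_integral_square_le:
  fixes D :: "real \<Rightarrow> real"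
  assumes ab: "a < b" and D: "set_integrable lborel {a..b} D"
    and D2: "set_integrable lborel {a..b} (\<lambda>t. (D t)\<^sup>2)"
  shows "(LINT t:{a..b}|lborel. D t)\<^sup>2 \<le> (b - a) * (LINT t:{a..b}|lborel. (D t)\<^sup>2)"
proof -
  define J where "J = (LINT t:{a..b}|lborel. D t)"
  define c where "c = J / (b - a)"
  have const: "set_integrable lborel {a..b} (\<lambda>t. c\<^sup>2)"
    "(LINT t:{a..b}|lborel. c\<^sup>2) = c\<^sup>2 * (b - a)"
    using ab by (simp_all add: set_integrable_def set_lebesgue_integral_def)
  have "0 \<le> (LINT t:{a..b}|lborel. (D t - c)\<^sup>2)"
    unfolding set_lebesgue_integral_def by (intro integral_nonneg_AE) simp
  also have "(\<lambda>t. (D t - c)\<^sup>2) = (\<lambda>t. (D t)\<^sup>2 - (2 * c) * D t + c\<^sup>2)"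
    by (auto simp: power2_eq_square algebra_simps)
  also have "(LINT t:{a..b}|lborel. (D t)\<^sup>2 - (2 * c) * D t + c\<^sup>2)
      = (LINT t:{a..b}|lborel. (D t)\<^sup>2) - 2 * c * J + c\<^sup>2 * (b - a)"
    using D D2 const by (simp add: J_def)
  finally have "2 * c * J - c\<^sup>2 * (b - a) \<le> (LINT t:{a..b}|lborel. (D t)\<^sup>2)" by simp
  moreover have "2 * c * J - c\<^sup>2 * (b - a) = J\<^sup>2 / (b - a)"
    using ab by (simp add: c_def power2_eq_square divide_simps)
  ultimately have "J\<^sup>2 / (b - a) \<le> (LINT t:{a..b}|lborel. (D t)\<^sup>2)" by simp
  then show ?thesis
    using ab by (simp add: J_def[symmetric] pos_divide_le_eq mult.commute)
qed

text \<open>As a function of \<open>t\<close>, \<open>indicator {..t} y\<close> is the distribution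
  function of the point mass at \<open>y\<close>.\<close>

lemma has_bochner_integral_indicator_atMost:
  fixes y :: real
  assumes "y \<in> {a..b}"
  shows "has_bochner_integral lborel (\<lambda>t. indicator {a..b} t * indicator {..t} y) (b - y)"
proof -
  have "(\<lambda>t. indicator {a..b} t * indicator {..t} y) = (indicator {y..b} :: real \<Rightarrow> real)"
    using assms by (auto simp: indicator_def)
  moreover have "has_bochner_integral lborel (indicator {y..b} :: real \<Rightarrow> real) (measure lborel {y..b})"
    by (rule has_bochner_integral_real_indicator) (auto simp: emeasure_lborel_Icc_eq)
  ultimately show ?thesis
    using assms by simp
qed

text \<open>Fubini reduces this to point masses: \<open>measure M {..t}\<close> is the
  \<open>M\<close>-average of their distribution functions, and each integrates to
  \<open>b - y\<close>.\<close>

lemma has_bochner_integral_cdf: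
  fixes M :: "real measure"
  assumes "prob_space M" and sets [measurable_cong]: "sets M = sets borel" and ae: "AE y in M. y \<in> {a..b}"
  shows "has_bochner_integral lborel (\<lambda>t. indicator {a..b} t * measure M {..t}) (b - (LINT y|M. y))"
proof -
  interpret prob_space M by fact
  interpret P: pair_sigma_finite lborel M ..
  let ?f = "\<lambda>t y. indicator {a..b} t * indicator {..t} y :: real"
  \<comment> \<open>Written with comparisons, the integrand is visibly measurable jointly in
    \<open>t\<close> and \<open>y\<close>.\<close>
  have f: "?f = (\<lambda>t y. if a \<le> t \<and> t \<le> b \<and> y \<le> t then 1 else 0)"
    by (auto simp: fun_eq_iff indicator_def)
  have sp: "space M = UNIV" using sets_eq_imp_space_eq[OF sets] by simp
  have int: "integrable (lborel \<Otimes>\<^sub>M M) (case_prod ?f)"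
  proof (rule integrableI_bounded_set[where A="{a..b} \<times> space M" and B=1])
    show "case_prod ?f \<in> borel_measurable (lborel \<Otimes>\<^sub>M M)"
      unfolding f by measurable
    show "emeasure (lborel \<Otimes>\<^sub>M M) ({a..b} \<times> space M) < \<infinity>"
      by (subst emeasure_pair_measure_Times) (auto simp: ennreal_mult_less_top emeasure_space_1 emeasure_lborel_Icc_eq)
  qed (auto simp: indicator_def sp)
  have inner: "(LINT y|M. ?f t y) = indicator {a..b} t * measure M {..t}" for t
    using sets by simp
  have "integrable M (\<lambda>y. y)"
    using ae by (intro integrable_const_bound[of _ "max \<bar>a\<bar> \<bar>b\<bar>"]) (auto simp: sets)
  moreover have "AE y in M. (LINT t|lborel. ?f t y) = b - y"
    using ae by eventually_elim (use has_bochner_integral_indicator_atMost has_bochner_integral_integral_eq in blast)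
  then have "(LINT y|M. (LINT t|lborel. ?f t y)) = (LINT y|M. b - y)"
    using borel_measurable_integrable[OF P.integrable_snd[OF int]]
    by (intro integral_cong_AE) (auto simp: sets)
  ultimately have "(LINT y|M. (LINT t|lborel. ?f t y)) = b - (LINT y|M. y)"
    by (simp add: prob_space)
  then show ?thesis
    using P.integrable_fst[OF int] P.Fubini_integral[OF int]
    by (simp only: inner has_bochner_integral_iff)
qed

text \<open>The difference \<open>D\<close> of the centred distribution functions integrates to the
  difference of the means, and the interval has length \<open>k - 1\<close>, so Cauchy-Schwarz
  applies. Here \<open>N\<close> stands for the law of the return.\<close>

lemma square_mean_diff_le_cramer:
  fixes p :: "real^'k::{finite,wellorder}"
  assumes k: "CARD('k) > 1" and N: "prob_space N" and sets: "sets N = sets borel"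
    and ae: "AE y in N. y \<in> {grid_point CARD('k) 1..grid_point CARD('k) CARD('k)}"
  shows "(zvec \<bullet> p - (LINT y|N. y))\<^sup>2
    \<le> (real CARD('k) - 1) * cramer CARD('k) (vec_measure p) (measure N)"
proof -
  interpret prob_space N by fact
  let ?k = "CARD('k)" and ?I = "\<lambda>y t. indicator {..t} y :: real"
  define a b where "a = grid_point ?k 1" and "b = grid_point ?k ?k"
  have ab: "b - a = real ?k - 1" "a < b"
    using k by (auto simp: a_def b_def grid_point_def field_simps)
  define s where "s = (\<Sum>j\<in>UNIV. p $ j)"
  define D where "D t = scdf (centred ?k (vec_measure p)) t - scdf (centred ?k (measure N)) t" for t
  have "measure N UNIV = 1"
    using prob_space sets_eq_imp_space_eq[OF sets] by simp
  then have D: "D t = ((\<Sum>j\<in>UNIV. p $ j * ?I (zvec $ j) t) - s / ?k * (\<Sum>i=1..?k. ?I (grid_point ?k i) t))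
      - (measure N {..t} - 1 / ?k * (\<Sum>i=1..?k. ?I (grid_point ?k i) t))" for t
    by (simp add: D_def scdf_def centred_def vec_measure_def s_def)
  have I: "has_bochner_integral lborel (\<lambda>t. indicator {a..b} t * ?I (grid_point ?k i) t) (b - grid_point ?k i)"
    if "i \<in> {1..?k}" for i
    using grid_point_in_interval[OF that]
    by (intro has_bochner_integral_indicator_atMost) (simp add: a_def b_def)
  have Z: "has_bochner_integral lborel (\<lambda>t. indicator {a..b} t * ?I (zvec $ j) t) (b - (zvec :: (real, 'k) vec) $ j)" for j
    using zvec_in_interval[of j]
    by (intro has_bochner_integral_indicator_atMost) (simp add: a_def b_def)
  \<comment> \<open>The interval indicator is pushed into every summand so that the integral can be
    computed term by term.\<close>
  have hbi: "has_bochner_integral lborel (\<lambda>t.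
      ((\<Sum>j\<in>UNIV. p $ j * (indicator {a..b} t * ?I (zvec $ j) t))
        - s / ?k * (\<Sum>i=1..?k. indicator {a..b} t * ?I (grid_point ?k i) t))
      - (indicator {a..b} t * measure N {..t}
        - 1 / ?k * (\<Sum>i=1..?k. indicator {a..b} t * ?I (grid_point ?k i) t)))
     (((\<Sum>j\<in>UNIV. p $ j * (b - (zvec :: (real, 'k) vec) $ j)) - s / ?k * (\<Sum>i=1..?k. b - grid_point ?k i))
      - ((b - (LINT y|N. y)) - 1 / ?k * (\<Sum>i=1..?k. b - grid_point ?k i)))"
    using ae by (intro has_bochner_integral_diff has_bochner_integral_sum has_bochner_integral_mult_right
        I Z has_bochner_integral_cdf N sets) (auto simp: a_def b_def)
  \<comment> \<open>The grid is symmetric, so the centring terms contribute \<open>s * b\<close> and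
    \<open>b\<close>. These cancel the \<open>b\<close>-parts of the two uncentred integrals and
    leave only the means.\<close>
  have sum_grid: "(\<Sum>i=1..?k. b - grid_point ?k i) = ?k * b"
    by (simp only: sum_subtractf sum_grid_point) simp
  have sum_z: "(\<Sum>j\<in>UNIV. p $ j * (b - (zvec :: (real, 'k) vec) $ j)) = s * b - zvec \<bullet> p"
    by (simp add: s_def inner_vec_def right_diff_distrib sum_subtractf sum_distrib_left mult.commute)
  have "has_bochner_integral lborel (\<lambda>t. indicator {a..b} t * D t) ((LINT y|N. y) - zvec \<bullet> p)"
  proof (rule has_bochner_integral_cong[THEN iffD1, OF refl _ _ hbi])
    show "((\<Sum>j\<in>UNIV. p $ j * (indicator {a..b} t * ?I (zvec $ j) t))
        - s / ?k * (\<Sum>i=1..?k. indicator {a..b} t * ?I (grid_point ?k i) t))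
      - (indicator {a..b} t * measure N {..t}
        - 1 / ?k * (\<Sum>i=1..?k. indicator {a..b} t * ?I (grid_point ?k i) t)) = indicator {a..b} t * D t" for t
      unfolding D by (cases "t \<in> {a..b}") (simp_all only: indicator_simps mult_1 mult_zero_left mult_zero_right
          sum.neutral_const diff_self simp_thms)
  qed (simp add: sum_grid sum_z flip: One_nat_def)
  then have J: "set_integrable lborel {a..b} D" "(LINT t:{a..b}|lborel. D t) = (LINT y|N. y) - zvec \<bullet> p"
    by (simp_all add: set_integrable_def set_lebesgue_integral_def has_bochner_integral_iff)
  \<comment> \<open>A crude uniform bound on \<open>D\<close>, one summand for each of the four
    terms; it makes the square of \<open>D\<close> integrable over the bounded interval.\<close>
  define c where "c = ((\<Sum>j\<in>UNIV. \<bar>p $ j\<bar>) + \<bar>s / ?k\<bar> * ?k) + (1 + 1 / ?k * ?k)"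
  have bound: "\<bar>D t\<bar> \<le> c" for t
  proof -
    have "\<bar>\<Sum>j\<in>UNIV. p $ j * ?I (zvec $ j) t\<bar> \<le> (\<Sum>j\<in>UNIV. \<bar>p $ j\<bar>)"
      by (intro order_trans[OF sum_abs] sum_mono) (auto simp: indicator_def)
    moreover have "\<bar>\<Sum>i=1..?k. ?I (grid_point ?k i) t\<bar> \<le> ?k"
      using sum_mono[of "{1..?k}" "\<lambda>i. \<bar>?I (grid_point ?k i) t\<bar>" "\<lambda>_. 1"]
      by (intro order_trans[OF sum_abs]) (simp add: indicator_def)
    then have "\<bar>d * (\<Sum>i=1..?k. ?I (grid_point ?k i) t)\<bar> \<le> \<bar>d\<bar> * ?k" for d
      unfolding abs_mult by (intro mult_left_mono) auto
    from this[of "s / ?k"] this[of "1 / ?k"]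
    have "\<bar>s / ?k * (\<Sum>i=1..?k. ?I (grid_point ?k i) t)\<bar> \<le> \<bar>s / ?k\<bar> * ?k"
      "\<bar>1 / ?k * (\<Sum>i=1..?k. ?I (grid_point ?k i) t)\<bar> \<le> 1 / ?k * ?k" by simp_all
    moreover have "\<bar>measure N {..t}\<bar> \<le> 1" by simp
    ultimately show ?thesis unfolding D c_def by linarith
  qed
  have "set_integrable lborel {a..b} (\<lambda>t. (D t)\<^sup>2)"
  proof -
    have "(\<lambda>t. indicator {a..b} t *\<^sub>R D t) \<in> borel_measurable lborel"
      using J(1) unfolding set_integrable_def by (rule borel_measurable_integrable)
    then have "(\<lambda>t. (indicator {a..b} t *\<^sub>R D t)\<^sup>2) \<in> borel_measurable lborel"
      by measurable
    also have "(\<lambda>t. (indicator {a..b} t *\<^sub>R D t)\<^sup>2) = (\<lambda>t. indicator {a..b} t *\<^sub>R (D t)\<^sup>2)"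
      by (auto simp: indicator_def)
    finally show ?thesis
      unfolding set_integrable_def using bound
      by (intro integrableI_bounded_set[where A="{a..b}" and B="c\<^sup>2"])
        (auto simp: indicator_def abs_le_square_iff[symmetric] emeasure_lborel_Icc_eq
          intro!: AE_I2 order_trans[OF bound])
  qed
  from set_integral_square_le[OF ab(2) J(1) this]
  have "((LINT y|N. y) - zvec \<bullet> p)\<^sup>2 \<le> (real ?k - 1) * cramer ?k (vec_measure p) (measure N)"
    by (simp only: J(2) ab(1) cramer_def D_def[symmetric] a_def[symmetric] b_def[symmetric])
  then show ?thesis by (simp add: power2_commute)
qed

subsection \<open>Range of the return\<close>

lemma trajectory_finite_dim:
  assumes "trajectory K rew x M X R" "\<And>t. B t \<in> sets borel"
  shows "measure M {\<omega> \<in> space M. \<forall>t\<le>n. X t \<omega> = xs t \<and> R t \<omega> \<in> B t} =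
    (if xs 0 = x then 1 else 0) * (\<Prod>t<n. pmf (K (xs t)) (xs (Suc t))) * (\<Prod>t\<le>n. measure (rew (xs t)) (B t))"
  using assms unfolding trajectory_def by simp

text \<open>The finite-dimensional laws prescribe the states as well, so the event that
  \<open>R t\<close> misses \<open>B\<close> is split over the finitely many state paths up to time
  \<open>t\<close>. Each piece has probability zero, since its product contains the factor
  \<open>measure (rew (xs t)) (- B)\<close>.\<close>

lemma trajectory_reward_AE:
  fixes K :: "'x::finite \<Rightarrow> 'x pmf"
  assumes traj: "trajectory K rew x M X R" and sets: "\<And>y. sets (rew y) = sets borel"
    and B: "B \<in> sets borel" and ae: "\<And>y. AE r in rew y. r \<in> B"
  shows "AE \<omega> in M. R t \<omega> \<in> B"
proof -
  interpret prob_space M using traj by (simp add: trajectory_def)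
  have [measurable]: "X s \<in> measurable M (count_space UNIV)" "R s \<in> borel_measurable M" for s
    using traj by (simp_all add: trajectory_def)
  note [measurable] = B
  \<comment> \<open>Constrains the reward at time \<open>t\<close> and leaves the earlier ones
    free.\<close>
  let ?B = "\<lambda>s. if s = t then - B else UNIV"
  have zero: "measure (rew y) (- B) = 0" for y
  proof -
    have "- B \<in> sets (rew y)" using B by (simp add: sets borel_comp)
    then have "- B \<in> null_sets (rew y)"
      using ae[of y] by (simp add: AE_iff_null_sets)
    then show ?thesis by (simp add: measure_eq_0_null_sets)
  qed
  have "AE \<omega> in M. \<forall>xs\<in>{..t} \<rightarrow>\<^sub>E (UNIV :: 'x set). \<not> (\<forall>s\<le>t. X s \<omega> = xs s \<and> R s \<omega> \<in> ?B s)"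
  proof (rule AE_finite_allI)
    show "finite ({..t} \<rightarrow>\<^sub>E (UNIV :: 'x set))" by (intro finite_PiE) auto
    fix xs
    let ?E = "{\<omega> \<in> space M. \<forall>s\<le>t. X s \<omega> = xs s \<and> R s \<omega> \<in> ?B s}"
    have Bs [measurable]: "?B s \<in> sets borel" for s using B by auto
    have "measure M ?E = (if xs 0 = x then 1 else 0) * (\<Prod>s<t. pmf (K (xs s)) (xs (Suc s)))
        * (\<Prod>s\<le>t. measure (rew (xs s)) (?B s))"
      by (rule trajectory_finite_dim[OF traj Bs])
    also have "(\<Prod>s\<le>t. measure (rew (xs s)) (?B s)) = 0"
      using zero by (intro prod_zero) auto
    finally have "prob ?E = 0" by simp
    moreover have "?E \<in> events" by measurable
    ultimately have "AE \<omega> in M. \<omega> \<notin> ?E" using prob_eq_0 by blast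
    then show "AE \<omega> in M. \<not> (\<forall>s\<le>t. X s \<omega> = xs s \<and> R s \<omega> \<in> ?B s)"
      using AE_space by eventually_elim blast
  qed
  then show ?thesis
  proof eventually_elim
    case (elim \<omega>)
    \<comment> \<open>The path actually followed is one of those excluded from having a reward
      outside \<open>B\<close>.\<close>
    have "restrict (\<lambda>s. X s \<omega>) {..t} \<in> {..t} \<rightarrow>\<^sub>E UNIV" by auto
    from bspec[OF elim this] show ?case by (auto split: if_splits)
  qed
qed

text \<open>Termwise comparison with the geometric series of the constant rewards
  \<open>(1 - \<gamma>) * a\<close> and \<open>(1 - \<gamma>) * b\<close>, whose discounted sums are
  \<open>a\<close> and \<open>b\<close>.\<close>

lemma discounted_sum_bounds:
  fixes \<gamma> :: real
  assumes \<gamma>: "0 \<le> \<gamma>" "\<gamma> < 1" and r: "\<And>t. r t \<in> {(1 - \<gamma>) * a..(1 - \<gamma>) * b}"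
  shows "(\<Sum>t. \<gamma> ^ t * r t) \<in> {a..b}"
proof -
  have geo: "(\<lambda>t. \<gamma> ^ t * ((1 - \<gamma>) * c)) sums c" for c
    using sums_mult2[OF geometric_sums[of \<gamma>], of "(1 - \<gamma>) * c"] \<gamma> by simp
  have "summable (\<lambda>t. \<gamma> ^ t * r t)"
  proof (rule summable_comparison_test')
    show "summable (\<lambda>t. \<gamma> ^ t * max \<bar>(1 - \<gamma>) * a\<bar> \<bar>(1 - \<gamma>) * b\<bar>)"
      using \<gamma> by (intro summable_mult2 summable_geometric) auto
    show "norm (\<gamma> ^ t * r t) \<le> \<gamma> ^ t * max \<bar>(1 - \<gamma>) * a\<bar> \<bar>(1 - \<gamma>) * b\<bar>" if "0 \<le> t" for t
      using r[of t] \<gamma> unfolding norm_mult by (intro mult_mono) auto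
  qed
  then have s: "(\<lambda>t. \<gamma> ^ t * r t) sums (\<Sum>t. \<gamma> ^ t * r t)" by (rule summable_sums)
  have "a \<le> (\<Sum>t. \<gamma> ^ t * r t)"
    using r \<gamma> by (intro sums_le[OF _ geo s] mult_left_mono) auto
  moreover have "(\<Sum>t. \<gamma> ^ t * r t) \<le> b"
    using r \<gamma> by (intro sums_le[OF _ s geo] mult_left_mono) auto
  ultimately show ?thesis by simp
qed

subsection \<open>The matrix \<open>C_lam\<close>\<close>

lemma eeT_mult_vec: "eeT *v v = (evec \<bullet> v) *\<^sub>R (evec :: real^'k::{finite,wellorder})"
  by (simp add: vec_eq_iff eeT_def matrix_vector_mult_def inner_vec_def sum_distrib_left sum_distrib_right mult_ac)

lemma transpose_eeT: "transpose eeT = eeT"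
  by (simp add: eeT_def transpose_def mult.commute)

lemma transpose_scaleR: "transpose (c *\<^sub>R A) = c *\<^sub>R transpose (A :: real^'n^'m)"
  by (simp add: vec_eq_iff transpose_def)

lemma transpose_add: "transpose (A + B) = transpose A + transpose (B :: real^'n^'m)"
  by (simp add: vec_eq_iff transpose_def)

lemma transpose_diff: "transpose (A - B) = transpose A - transpose (B :: real^'n^'m)"
  by (simp add: vec_eq_iff transpose_def)

lemma transpose_C_lam: "transpose (C_lam lam) = (C_lam lam :: real^'k::{finite,wellorder}^'k::{finite,wellorder})"
  by (simp add: C_lam_def transpose_add transpose_diff transpose_scaleR matrix_transpose_mul
      transpose_eeT transpose_mat matrix_mul_assoc)

lemma invertible_Cmat: "invertible (Cmat :: real^'k::{finite,wellorder}^'k::{finite,wellorder})"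
proof -
  have "det (Cmat :: ((real, 'k) vec, 'k) vec) = (\<Prod>i\<in>UNIV. (Cmat :: ((real, 'k) vec, 'k) vec) $ i $ i)"
    by (rule det_lowerdiagonal) (simp add: Cmat_def)
  then show ?thesis by (simp add: invertible_det_nz Cmat_def)
qed

text \<open>With \<open>?P\<close> the orthogonal projection along \<open>evec\<close>, the form
  equals the squared norm of \<open>transpose ?C *v (?P *v v)\<close> plus
  \<open>lam * (evec \<bullet> v)\<^sup>2\<close>. If \<open>v\<close> is orthogonal to
  \<open>evec\<close>, then \<open>?P\<close> fixes it and invertibility of \<open>Cmat\<close>
  makes the first term positive; otherwise the second term is positive.\<close>

lemma C_lam_pos_def:
  fixes v :: "real^'k::{finite,wellorder}"
  assumes "lam > 0" "v \<noteq> 0"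
  shows "0 < v \<bullet> (C_lam lam *v v)"
proof -
  let ?P = "mat 1 - eeT :: ((real, 'k) vec, 'k) vec" and ?C = "Cmat :: ((real, 'k) vec, 'k) vec"
  have P: "?P *v u = u - (evec \<bullet> u) *\<^sub>R evec" for u
    by (simp add: matrix_vector_mult_diff_rdistrib eeT_mult_vec)
  have sym: "u \<bullet> (?P *v w) = (?P *v u) \<bullet> w" for u w
    by (simp add: P inner_diff_left inner_diff_right inner_commute)
  have adj: "u \<bullet> (?P *v (?C *v w)) = (transpose ?C *v (?P *v u)) \<bullet> w" for u w
    by (simp only: sym transpose_matrix_vector dot_lmul_matrix)
  have "v \<bullet> (C_lam lam *v v) = v \<bullet> (?P *v (?C *v (transpose ?C *v (?P *v v)))) + lam * (evec \<bullet> v)\<^sup>2"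
    by (simp add: C_lam_def matrix_vector_mult_add_rdistrib scaleR_matrix_vector_assoc[symmetric]
        matrix_vector_mul_assoc[symmetric] eeT_mult_vec inner_add_right power2_eq_square inner_commute
        del: transpose_matrix_vector)
  also have "v \<bullet> (?P *v (?C *v (transpose ?C *v (?P *v v)))) = (norm (transpose ?C *v (?P *v v)))\<^sup>2"
    by (simp only: adj dot_square_norm)
  finally have eq: "v \<bullet> (C_lam lam *v v) = (norm (transpose ?C *v (?P *v v)))\<^sup>2 + lam * (evec \<bullet> v)\<^sup>2" .
  show ?thesis
  proof (cases "evec \<bullet> v = 0")
    case True
    then have "?P *v v = v" by (simp add: P)
    moreover have "inj ((*v) (transpose ?C))"
      by (intro inj_matrix_vector_mult transpose_invertible invertible_Cmat)
    then have "transpose ?C *v v \<noteq> 0"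
      using assms(2) by (metis injD matrix_vector_mult_0_right)
    ultimately show ?thesis unfolding eq using True by simp
  next
    case False
    then show ?thesis unfolding eq using assms(1) by (simp add: add_nonneg_pos)
  qed
qed

text \<open>The difference \<open>w\<close> of the last and first unit vectors is orthogonal to
  \<open>evec\<close>, so the projection fixes it and the \<open>lam\<close> term vanishes. Applying
  the transpose of \<open>Cmat\<close> and then \<open>Cmat\<close> produces the ranks shifted by
  one, and the final projection centres them to \<open>zvec\<close>.\<close>

lemma C_lam_solves_zvec:
  obtains w :: "real^'k::{finite,wellorder}"
  where "C_lam lam *v w = zvec" "w \<bullet> zvec = real CARD('k) - 1"
proof -
  let ?P = "mat 1 - eeT :: ((real, 'k) vec, 'k) vec" and ?C = "Cmat :: ((real, 'k) vec, 'k) vec"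
  let ?n = "real CARD('k)"
  define lo hi where "lo = Min (UNIV :: 'k set)" and "hi = Max (UNIV :: 'k set)"
  have lo: "lo \<le> j" and hi: "j \<le> hi" for j by (simp_all add: lo_def hi_def)
  define w :: "(real, 'k) vec" where "w = axis hi 1 - axis lo 1"
  have P: "?P *v u = u - (evec \<bullet> u) *\<^sub>R evec" for u
    by (simp add: matrix_vector_mult_diff_rdistrib eeT_mult_vec)
  have ew: "evec \<bullet> w = 0"
    by (simp add: w_def inner_diff_right inner_axis evec_def)
  have C: "?C $ i $ j = (if j \<le> i then 1 else 0)" for i j
    by (simp add: Cmat_def)
  have Cw: "(transpose ?C *v w) $ i = 1 - (if i = lo then 1 else 0)" for i
  proof -
    \<comment> \<open>Row \<open>hi\<close> of \<open>Cmat\<close> is all ones, and row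
      \<open>lo\<close> has its single one at \<open>lo\<close>.\<close>
    have "(transpose ?C *v w) $ i = ?C $ hi $ i - ?C $ lo $ i"
      unfolding w_def matrix_vector_mult_diff_distrib vector_minus_component
      by (simp add: matrix_vector_mult_basis column_def transpose_def del: transpose_matrix_vector)
    then show ?thesis using lo[of i] hi[of i] by (auto simp: Cmat_def)
  qed
  have CCw: "(?C *v (transpose ?C *v w)) $ i = real (coord_index i) - 1" for i
  proof -
    have "(?C *v (transpose ?C *v w)) $ i = (\<Sum>j\<in>UNIV. (if j \<le> i then 1 else 0) * (1 - (if j = lo then 1 else 0)))"
      by (simp only: matrix_vector_mul_component[of ?C] inner_vec_def C Cw inner_real_def)
    also have "\<dots> = (\<Sum>j\<in>UNIV. (if j \<in> {..i} then 1 else 0) - (if j = lo then 1 else 0))"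
      using lo[of i] by (intro sum.cong) auto
    also have "\<dots> = real (coord_index i) - 1"
      by (simp add: sum_subtractf sum.If_cases coord_index_def atMost_def)
    finally show ?thesis .
  qed
  \<comment> \<open>The shift between \<open>coord_index i - 1\<close> and the support point is the
    constant \<open>(?n - 1) / 2\<close>; the factor \<open>sqrt ?n\<close> expresses it as a
    multiple of the unit vector \<open>evec\<close>, which \<open>?P\<close> annihilates.\<close>
  have CCw': "?C *v (transpose ?C *v w) = zvec + ((?n - 1) / 2 * sqrt ?n) *\<^sub>R evec"
    by (simp add: vec_eq_iff CCw zvec_def grid_point_def evec_def field_simps del: transpose_matrix_vector)
  have ee: "evec \<bullet> (evec :: (real, 'k) vec) = 1"
    by (simp add: inner_vec_def evec_def)
  have ez: "evec \<bullet> (zvec :: (real, 'k) vec) = 0"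
    using sum_zvec[where 'k='k] by (simp add: inner_vec_def evec_def sum_divide_distrib[symmetric])
  have "C_lam lam *v w = ?P *v (?C *v (transpose ?C *v (?P *v w))) + lam *\<^sub>R (eeT *v w)"
    by (simp add: C_lam_def matrix_vector_mult_add_rdistrib scaleR_matrix_vector_assoc[symmetric]
        matrix_vector_mul_assoc[symmetric] del: transpose_matrix_vector)
  also have "?P *v w = w" by (simp add: P ew)
  finally have "C_lam lam *v w = zvec"
    by (simp add: CCw' P ee ez ew eeT_mult_vec inner_add_right algebra_simps del: transpose_matrix_vector)
  moreover have "coord_index lo = 1"
  proof -
    have "{..lo} = {lo}" using lo by (auto intro: antisym)
    then show ?thesis by (simp add: coord_index_def)
  qed
  moreover have "coord_index hi = CARD('k)"
  proof -
    have "{..hi} = UNIV" using hi by auto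
    then show ?thesis by (simp add: coord_index_def)
  qed
  ultimately show thesis
    by (intro that[of w]) (simp_all add: w_def inner_diff_left inner_axis' zvec_def grid_point_def field_simps)
qed

theorem theorem2:
  fixes K :: "'x::finite \<Rightarrow> 'x pmf"
    and rew :: "'x \<Rightarrow> real measure"
    and \<gamma> lam :: real
    and \<xi> :: "'x pmf"
    and \<Phi> :: "real^'m^'x"
    and Pt :: "real^'k::{finite,wellorder}^'x"
    and M :: "'x \<Rightarrow> 'w measure"
    and X :: "'x \<Rightarrow> nat \<Rightarrow> 'w \<Rightarrow> 'x"
    and R :: "'x \<Rightarrow> nat \<Rightarrow> 'w \<Rightarrow> real"
  assumes k: "odd CARD('k)" "CARD('k) \<ge> 3"
    and gamma: "0 \<le> \<gamma>" "\<gamma> < 1"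
    and lam: "lam > 0"
    and rew_prob: "\<And>x. prob_space (rew x)" "\<And>x. sets (rew x) = sets borel"
    and rew_bounded: "\<And>x. \<exists>b. AE r in rew x. \<bar>r\<bar> \<le> b"
    and rew_support: "\<And>x i. i \<in> {1..CARD('k)} \<Longrightarrow>
      AE r in rew x. r + \<gamma> * grid_point CARD('k) i \<in> {grid_point CARD('k) 1..<grid_point CARD('k) CARD('k)}"
    and stationary: "\<And>x'. pmf \<xi> x' = (\<Sum>x\<in>UNIV. pmf \<xi> x * pmf (K x) x')"
    and traj: "\<And>x. trajectory K rew x (M x) (X x) (R x)"
    and fixed_point: "is_proj \<xi> lam \<Phi> (bellman K rew \<gamma> (\<lambda>x. vec_measure (Pt $ x))) Pt"
  shows "sqnorm_w \<xi> (\<lambda>x. zvec \<bullet> (Pt $ x) - return_mean \<gamma> (M x) (R x))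
    \<le> (norm (matrix_inv_sqrt (C_lam lam) *v (zvec :: real^'k::{finite,wellorder})))\<^sup>2 *
       ell2_w CARD('k) \<xi> lam (\<lambda>x. vec_measure (Pt $ x)) (\<lambda>x. return_law \<gamma> (M x) (R x))"
proof -
  let ?k = "CARD('k)"
  define a b where "a = grid_point ?k 1" and "b = grid_point ?k ?k"
  have k1: "?k > 1" using k(2) by simp
  obtain w :: "(real, 'k) vec" where w: "C_lam lam *v w = zvec" "w \<bullet> zvec = real ?k - 1"
    by (rule C_lam_solves_zvec)
  have coeff: "(norm (matrix_inv_sqrt (C_lam lam) *v (zvec :: (real, 'k) vec)))\<^sup>2 = real ?k - 1"
    using norm_matrix_inv_sqrt[OF transpose_C_lam C_lam_pos_def[OF lam], of w] w by simp
  have state: "(zvec \<bullet> (Pt $ x) - return_mean \<gamma> (M x) (R x))\<^sup>2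
      \<le> (real ?k - 1) * ell2 ?k lam (vec_measure (Pt $ x)) (return_law \<gamma> (M x) (R x))" for x
  proof -
    interpret prob_space "M x" using traj[of x] by (simp add: trajectory_def)
    have [measurable]: "R x t \<in> borel_measurable (M x)" for t
      using traj[of x] by (simp add: trajectory_def)
    have meas [measurable]: "disc_return \<gamma> (R x) \<in> borel_measurable (M x)"
      unfolding disc_return_def by measurable
    \<comment> \<open>The support condition at the two end points: \<open>r + \<gamma> * a\<close>
      being at least \<open>a\<close> gives the lower bound, and \<open>r + \<gamma> * b\<close>
      being below \<open>b\<close> the upper one.\<close>
    have "AE r in rew y. r \<in> {(1 - \<gamma>) * a..(1 - \<gamma>) * b}" for y
    proof -
      have "AE r in rew y. r + \<gamma> * a \<in> {a..<b}" "AE r in rew y. r + \<gamma> * b \<in> {a..<b}"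
        unfolding a_def b_def using k1 by (intro rew_support; simp)+
      then show ?thesis by eventually_elim (auto simp: algebra_simps)
    qed
    then have "AE \<omega> in M x. R x t \<omega> \<in> {(1 - \<gamma>) * a..(1 - \<gamma>) * b}" for t
      by (intro trajectory_reward_AE[OF traj rew_prob(2)]) auto
    \<comment> \<open>Countably many null sets are merged, so that the bound on the series can be
      applied pathwise.\<close>
    then have "AE \<omega> in M x. \<forall>t. R x t \<omega> \<in> {(1 - \<gamma>) * a..(1 - \<gamma>) * b}"
      by (simp only: AE_all_countable) blast
    then have "AE \<omega> in M x. disc_return \<gamma> (R x) \<omega> \<in> {a..b}"
      by eventually_elim (unfold disc_return_def, intro discounted_sum_bounds[OF gamma], blast)
    then have ae: "AE y in distr (M x) borel (disc_return \<gamma> (R x)). y \<in> {a..b}"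
      by (subst AE_distr_iff) auto
    have law: "return_law \<gamma> (M x) (R x) = measure (distr (M x) borel (disc_return \<gamma> (R x)))"
      by (simp add: return_law_def fun_eq_iff)
    have mean: "return_mean \<gamma> (M x) (R x) = (LINT y|distr (M x) borel (disc_return \<gamma> (R x)). y)"
      by (subst integral_distr) (auto simp: return_mean_def)
    have "(zvec \<bullet> (Pt $ x) - return_mean \<gamma> (M x) (R x))\<^sup>2
        \<le> (real ?k - 1) * cramer ?k (vec_measure (Pt $ x)) (return_law \<gamma> (M x) (R x))"
      unfolding law mean using ae
      by (intro square_mean_diff_le_cramer[OF k1 prob_space_distr[OF meas]]) (simp_all add: a_def b_def)
    \<comment> \<open>\<open>ell2\<close> exceeds \<open>cramer\<close> by the nonnegative penalty
      on the difference of total masses.\<close>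
    also have "\<dots> \<le> (real ?k - 1) * ell2 ?k lam (vec_measure (Pt $ x)) (return_law \<gamma> (M x) (R x))"
      unfolding ell2_def using k1 lam by (intro mult_left_mono) auto
    finally show ?thesis .
  qed
  have "sqnorm_w \<xi> (\<lambda>x. zvec \<bullet> (Pt $ x) - return_mean \<gamma> (M x) (R x))
      \<le> (\<Sum>x\<in>UNIV. pmf \<xi> x * ((real ?k - 1) * ell2 ?k lam (vec_measure (Pt $ x)) (return_law \<gamma> (M x) (R x))))"
    unfolding sqnorm_w_def by (intro sum_mono mult_left_mono state) simp
  then show ?thesis
    unfolding coeff by (simp add: ell2_w_def sum_distrib_left mult_ac)
qed

end
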